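(* Let $H$ be a finite simple undirected graph with chromatic number $\chi\ge 2$ and let $G$ be the graph obtained by fully subdividing $H$. Then $$\mathrm{box}(G) \leq \lceil \log_2 \log_2 \chi \rceil + 3.$$
   Context: A graph $G$ is obtained by fully subdividing $H$ if $G$ results from subdividing every edge of $H$ exactly once, i.e. each edge $\{u,v\}$ of $H$ is replaced by a path $u,w,v$ with a new vertex $w$ (a different new vertex for each edge). For a positive integer $k$, a $k$-box is a Cartesian product $R_1\times\cdots\times R_k\subseteq\mathbb{R}^k$ of closed intervals $R_i=[a_i,b_i]$. The boxicity $\mathrm{box}(G)$ of a finite simple graph $G$ is the minimum positive integer $k$ such that one can assign to each vertex of $G$ a $k$-box so that two distinct vertices are adjacent if and only if their boxes have non-empty intersection (in particular complete graphs have boxicity $1$). *)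

theory Defs
  imports Complex_Main "HOL-Library.FuncSet" "Graph_Theory.Graph_Theory"
begin

text \<open>
  A finite simple undirected graph is a \<^locale>\<open>pair_graph\<close>: a finite loop-free symmetric set of
  arcs, where the edge \<open>{u, v}\<close> is represented by the two arcs \<open>(u, v)\<close> and \<open>(v, u)\<close>.
\<close>

definition uedges :: "'a pair_pre_digraph \<Rightarrow> 'a set set" where
  "uedges G = {{u, v} | u v. (u, v) \<in> parcs G}"


definition proper_coloring :: "'a pair_pre_digraph \<Rightarrow> nat \<Rightarrow> ('a \<Rightarrow> nat) \<Rightarrow> bool" where
  "proper_coloring G k c \<longleftrightarrow>
     c ` pverts G \<subseteq> {..<k} \<and> (\<forall>(u, v) \<in> parcs G. c u \<noteq> c v)"

definition chromatic_number :: "'a pair_pre_digraph \<Rightarrow> nat" where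
  "chromatic_number G = (LEAST k. \<exists>c. proper_coloring G k c)"

lemma (in pair_graph) chromatic_number_attained:
  "\<exists>c. proper_coloring G (chromatic_number G) c"
proof -
  obtain f :: "'a \<Rightarrow> nat" and n where f: "f ` pverts G = {i. i < n}" "inj_on f (pverts G)"
    using finite_imp_inj_to_nat_seg[OF pair_finite_verts] by blast
  have "f u \<noteq> f v" if "(u, v) \<in> parcs G" for u v
    using that f(2) pair_no_loops[OF that] in_arcsD1[OF that] in_arcsD2[OF that]
    by (auto dest: inj_onD)
  then have "proper_coloring G n f"
    using f(1) unfolding proper_coloring_def by auto
  then have "\<exists>k c. proper_coloring G k c"
    by blast
  then show ?thesis
    unfolding chromatic_number_def by (rule LeastI_ex)
qed


text \<open>The vertex \<open>Inr e\<close> is the one that subdivides the edge \<open>e\<close>.\<close>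

definition full_subdivision :: "'a pair_pre_digraph \<Rightarrow> ('a + 'a set) pair_pre_digraph" where
  "full_subdivision H =
     \<lparr> pverts = Inl ` pverts H \<union> Inr ` uedges H,
       parcs = {(Inl u, Inr e) | u e. e \<in> uedges H \<and> u \<in> e}
             \<union> {(Inr e, Inl u) | u e. e \<in> uedges H \<and> u \<in> e} \<rparr>"

lemma (in pair_graph) finite_uedges: "finite (uedges G)"
proof -
  have "uedges G = (\<lambda>(u, v). {u, v}) ` parcs G"
    unfolding uedges_def by force
  then show ?thesis
    using pair_finite_arcs by simp
qed

lemma (in pair_graph) uedges_subset_pverts: "e \<in> uedges G \<Longrightarrow> u \<in> e \<Longrightarrow> u \<in> pverts G"
  unfolding uedges_def using in_arcsD1 in_arcsD2 by fastforce

lemma (in pair_graph) pair_graph_full_subdivision: "pair_graph (full_subdivision G)"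
proof -
  have sub: "parcs (full_subdivision G) \<subseteq>
      pverts (full_subdivision G) \<times> pverts (full_subdivision G)"
    unfolding full_subdivision_def using uedges_subset_pverts by auto
  have fin: "finite (pverts (full_subdivision G))"
    unfolding full_subdivision_def using pair_finite_verts finite_uedges by simp
  then have "finite (parcs (full_subdivision G))"
    using sub finite_subset by blast
  moreover have "symmetric (full_subdivision G)"
    unfolding symmetric_def full_subdivision_def by (auto intro!: symI)
  ultimately show ?thesis
  proof unfold_locales
    fix e assume e: "e \<in> parcs (full_subdivision G)"
    then show "fst e \<in> pverts (full_subdivision G)" "snd e \<in> pverts (full_subdivision G)"
      using sub by auto
    from e show "fst e \<noteq> snd e"
      by (auto simp: full_subdivision_def)
  qed (use fin in auto)
qed


text \<open>
  Since the dimension \<open>k\<close> varies, a point of \<open>k\<close>-dimensional real space is an extensional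
  function on \<open>{..<k}\<close>.
\<close>

definition kbox :: "nat \<Rightarrow> (nat \<Rightarrow> real) set \<Rightarrow> bool" where
  "kbox k R \<longleftrightarrow> (\<exists>a b. (\<forall>i<k. a i \<le> b i) \<and> R = (\<Pi>\<^sub>E i\<in>{..<k}. {a i..b i}))"

definition box_representation ::
    "'a pair_pre_digraph \<Rightarrow> nat \<Rightarrow> ('a \<Rightarrow> (nat \<Rightarrow> real) set) \<Rightarrow> bool" where
  "box_representation G k R \<longleftrightarrow>
     (\<forall>v \<in> pverts G. kbox k (R v)) \<and>
     (\<forall>u \<in> pverts G. \<forall>v \<in> pverts G.
        u \<noteq> v \<longrightarrow> ((u, v) \<in> parcs G \<longleftrightarrow> R u \<inter> R v \<noteq> {}))"

definition boxicity :: "'a pair_pre_digraph \<Rightarrow> nat" where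
  "boxicity G = (LEAST k. k \<ge> 1 \<and> (\<exists>R. box_representation G k R))"

lemma (in pair_graph) boxicity_attained:
  "boxicity G \<ge> 1 \<and> (\<exists>R. box_representation G (boxicity G) R)"
proof -
  obtain f :: "'a \<Rightarrow> nat" and n where f: "f ` pverts G = {i. i < n}" "inj_on f (pverts G)"
    using finite_imp_inj_to_nat_seg[OF pair_finite_verts] by blast
  define a :: "'a \<Rightarrow> nat \<Rightarrow> real" where
    "a v i = (if f v = i \<or> (\<exists>w \<in> pverts G. f w = i \<and> (v, w) \<in> parcs G) then 0 else 1)" for v i
  define b :: "'a \<Rightarrow> nat \<Rightarrow> real" where "b v i = (if f v = i then 0 else 1)" for v i
  define R where "R v = (\<Pi>\<^sub>E i\<in>{..<Suc n}. {a v i..b v i})" for v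
  have ab: "a v i \<le> b v i" for v i
    by (simp add: a_def b_def)
  have "box_representation G (Suc n) R"
    unfolding box_representation_def
  proof (intro conjI ballI impI iffI)
    fix v
    show "kbox (Suc n) (R v)"
      unfolding kbox_def R_def using ab by blast
  next
    fix u v assume uv: "u \<in> pverts G" "v \<in> pverts G" "u \<noteq> v"
    then have ne: "f u \<noteq> f v"
      using f(2) by (auto dest: inj_onD)
    {
      assume arc: "(u, v) \<in> parcs G"
      then have "(v, u) \<in> parcs G"
        using pair_sym_arcs unfolding symmetric_def by (auto dest: symD)
      with arc uv have "a u i \<le> (if f u = i \<or> f v = i then 0 else 1)"
        "a v i \<le> (if f u = i \<or> f v = i then 0 else 1)" for i
        unfolding a_def by auto
      moreover have "(if f u = i \<or> f v = i then 0 else 1) \<le> b u i"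
        "(if f u = i \<or> f v = i then 0 else 1) \<le> b v i" for i
        unfolding b_def by auto
      ultimately have
        "(\<lambda>i\<in>{..<Suc n}. if f u = i \<or> f v = i then 0 else 1) \<in> R u \<inter> R v"
        unfolding R_def by (intro IntI restrict_PiE_iff[THEN iffD2] ballI) simp_all
      then show "R u \<inter> R v \<noteq> {}" by blast
    next
      assume "R u \<inter> R v \<noteq> {}"
      then obtain x where "x \<in> R u" "x \<in> R v" by blast
      moreover have "f v < Suc n"
        using imageI[OF uv(2), of f] unfolding f(1) by simp
      ultimately have "a u (f v) \<le> x (f v)" "x (f v) \<le> b v (f v)"
        unfolding R_def using PiE_mem by fastforce+
      then have "a u (f v) \<le> 0"
        by (simp add: b_def)
      then obtain w where "w \<in> pverts G" "f w = f v" "(u, w) \<in> parcs G"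
        using ne by (auto simp: a_def split: if_splits)
      then show "(u, v) \<in> parcs G"
        using f(2) uv(2) by (auto dest: inj_onD)
    }
  qed
  then have "\<exists>k\<ge>1. \<exists>R. box_representation G k R"
    by (intro exI[of _ "Suc n"]) auto
  then show ?thesis
    unfolding boxicity_def by (rule LeastI_ex)
qed

end

theory Submission
  imports Defs
begin

text \<open>
  Let \<open>d = \<lceil>log\<^sub>2 log\<^sub>2 \<chi>\<rceil>\<close>. By repeated squaring there are \<open>d + 1\<close> linear orders of the
  \<open>2^(2^d) \<ge> \<chi>\<close> colours such that among any three colours each one lies outside the other two in
  some order. Order the vertices of \<open>H\<close> by these orders of their colours, breaking ties by a fixed
  enumeration, and once more by the first order with the ties reversed. In each of these \<open>d + 2\<close>
  coordinates a vertex is a point and an edge spans the interval between its ends. As the ends of an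
  edge have different colours, every other vertex leaves this interval in some coordinate; ties are
  resolved by the reversed order. One more coordinate, in which the edges are distinct points and
  each vertex is an interval covering all of them, separates the edges from each other.
\<close>

section \<open>Separating families of orders and their lexicographic extension\<close>

definition outside :: "int \<Rightarrow> int \<Rightarrow> int \<Rightarrow> bool" where
  "outside b a c \<longleftrightarrow> b < min a c \<or> max a c < b"

text \<open>The condition on triples is vacuous for fewer than three elements. Injectivity of
  \<open>f 0\<close> makes index \<open>0\<close> a strict order on all of \<open>S\<close>, so that
  breaking its ties in both directions can separate equal colours.\<close>

definition separating :: "(nat \<Rightarrow> 'a \<Rightarrow> int) \<Rightarrow> nat \<Rightarrow> 'a set \<Rightarrow> bool" where
  "separating f d S \<longleftrightarrow> inj_on (f 0) S \<and>
     (\<forall>a \<in> S. \<forall>b \<in> S. \<forall>c \<in> S. distinct [a, b, c] \<longrightarrow> (\<exists>i\<le>d. outside (f i b) (f i a) (f i c)))"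

lemma separating_subset: "separating f d S \<Longrightarrow> T \<subseteq> S \<Longrightarrow> separating f d T"
  unfolding separating_def by (blast intro: inj_on_subset)

text \<open>
  For \<open>\<bar>s\<bar> < M\<close> this compares lexicographically by \<open>f i \<circ> col\<close> and then \<open>s i\<close>; the last index
  \<open>d + 1\<close> repeats the index \<open>0\<close> with reversed ties.
\<close>
definition lex_extend ::
    "(nat \<Rightarrow> 'b \<Rightarrow> int) \<Rightarrow> (nat \<Rightarrow> 'a \<Rightarrow> int) \<Rightarrow> int \<Rightarrow> ('a \<Rightarrow> 'b) \<Rightarrow> nat \<Rightarrow> nat \<Rightarrow> 'a \<Rightarrow> int" where
  "lex_extend f s M col d i u =
     (if i \<le> d then 2 * M * f i (col u) + s i u else 2 * M * f 0 (col u) - s 0 u)"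

text \<open>The main terms differ by at least \<open>2 * M\<close>, while the perturbations
  \<open>q\<close> and \<open>q'\<close> differ by less than that.\<close>

lemma lex_less:
  fixes p p' q q' M :: int
  assumes "p < p'" "\<bar>q\<bar> < M" "\<bar>q'\<bar> < M"
  shows "2 * M * p + q < 2 * M * p' + q'"
proof -
  have "2 * M * (p + 1) \<le> 2 * M * p'"
    using assms by (intro mult_left_mono) auto
  then show ?thesis
    using assms by (simp add: algebra_simps)
qed

lemma lex_extend_less:
  assumes "\<And>i u. i \<le> d \<Longrightarrow> u \<in> V \<Longrightarrow> \<bar>s i u\<bar> < M"
    and "u \<in> V" "v \<in> V" "f (if i \<le> d then i else 0) (col u) < f (if i \<le> d then i else 0) (col v)"
  shows "lex_extend f s M col d i u < lex_extend f s M col d i v"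
proof (cases "i \<le> d")
  case True
  then show ?thesis
    using lex_less[of "f i (col u)" "f i (col v)" "s i u" M "s i v"] assms
    by (simp add: lex_extend_def)
next
  case False
  then show ?thesis
    using lex_less[of "f 0 (col u)" "f 0 (col v)" "- s 0 u" M "- s 0 v"] assms
    by (simp add: lex_extend_def)
qed

lemma outside_lex_extend:
  assumes s: "\<And>i u. i \<le> d \<Longrightarrow> u \<in> V \<Longrightarrow> \<bar>s i u\<bar> < M"
    and V: "a \<in> V" "b \<in> V" "c \<in> V"
    and i: "i \<le> d" "outside (f i (col b)) (f i (col a)) (f i (col c))"
  shows "outside (lex_extend f s M col d i b) (lex_extend f s M col d i a)
           (lex_extend f s M col d i c)"
proof -
  have "lex_extend f s M col d i u < lex_extend f s M col d i v"
    if "u \<in> V" "v \<in> V" "f i (col u) < f i (col v)" for u v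
    by (rule lex_extend_less[of d V s]) (use s that i in auto)
  then show ?thesis
    using i V unfolding outside_def by auto
qed

lemma inj_on_lex_extend:
  assumes s: "\<And>i u. i \<le> d \<Longrightarrow> u \<in> V \<Longrightarrow> \<bar>s i u\<bar> < M"
    and f: "inj_on (f 0) (col ` V)"
    and ties: "\<And>u v. u \<in> V \<Longrightarrow> v \<in> V \<Longrightarrow> col u = col v \<Longrightarrow> s 0 u = s 0 v \<Longrightarrow> u = v"
  shows "inj_on (lex_extend f s M col d 0) V"
proof (rule inj_onI)
  fix u v assume uv: "u \<in> V" "v \<in> V" "lex_extend f s M col d 0 u = lex_extend f s M col d 0 v"
  then have "f 0 (col u) = f 0 (col v)"
    using lex_extend_less[of d V s M u v f 0 col, OF s]
      lex_extend_less[of d V s M v u f 0 col, OF s]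
    by (cases "f 0 (col u)" "f 0 (col v)" rule: linorder_cases) auto
  then show "u = v"
    using uv f ties[of u v] by (auto simp: lex_extend_def dest: inj_onD)
qed

text \<open>At the indices \<open>0\<close> and \<open>Suc d\<close> the point \<open>c\<close> lies
  on the same side of both \<open>a\<close> and \<open>b\<close>, whereas the tie between
  \<open>a\<close> and \<open>b\<close> is broken in opposite ways. So at one of the two indices
  \<open>b\<close> lies beyond \<open>a\<close> as seen from \<open>c\<close>.\<close>

lemma ex_outside_tie:
  assumes s: "\<And>i u. i \<le> d \<Longrightarrow> u \<in> V \<Longrightarrow> \<bar>s i u\<bar> < M"
    and f: "inj_on (f 0) (col ` V)"
    and ties: "\<And>u v. u \<in> V \<Longrightarrow> v \<in> V \<Longrightarrow> col u = col v \<Longrightarrow> s 0 u = s 0 v \<Longrightarrow> u = v"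
    and V: "a \<in> V" "b \<in> V" "c \<in> V" "a \<noteq> b" "col b = col a" "col a \<noteq> col c"
  shows "\<exists>i \<le> Suc d. outside (lex_extend f s M col d i b) (lex_extend f s M col d i a)
           (lex_extend f s M col d i c)"
proof -
  let ?p = "lex_extend f s M col d"
  have less: "?p i u < ?p i v"
    if "u \<in> V" "v \<in> V" "f 0 (col u) < f 0 (col v)" "i = 0 \<or> i = Suc d" for i u v
    by (rule lex_extend_less[of d V s]) (use s that in auto)
  have tie: "?p 0 b < ?p 0 a \<and> ?p (Suc d) a < ?p (Suc d) b \<or>
      ?p 0 a < ?p 0 b \<and> ?p (Suc d) b < ?p (Suc d) a"
    using V ties[of a b] by (cases "s 0 a" "s 0 b" rule: linorder_cases) (auto simp: lex_extend_def)
  have "f 0 (col a) \<noteq> f 0 (col c)"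
    using f V by (auto dest: inj_onD)
  then have "outside (?p 0 b) (?p 0 a) (?p 0 c) \<or>
      outside (?p (Suc d) b) (?p (Suc d) a) (?p (Suc d) c)"
    using tie less[of b c] less[of c b] V unfolding outside_def
    by (cases "f 0 (col a)" "f 0 (col c)" rule: linorder_cases) auto
  then show ?thesis
    by auto
qed

lemma outside_commute: "outside b a c \<longleftrightarrow> outside b c a"
  unfolding outside_def by (simp add: min.commute max.commute)

text \<open>At most one of \<open>a\<close> and \<open>c\<close> has the colour of \<open>b\<close>.
  Such a tie is settled by the reversed order; otherwise the three colours are distinct and their
  separation carries over.\<close>

lemma ex_outside_lex_extend:
  assumes s: "\<And>i u. i \<le> d \<Longrightarrow> u \<in> V \<Longrightarrow> \<bar>s i u\<bar> < M"
    and f: "separating f d (col ` V)"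
    and ties: "\<And>u v. u \<in> V \<Longrightarrow> v \<in> V \<Longrightarrow> col u = col v \<Longrightarrow> s 0 u = s 0 v \<Longrightarrow> u = v"
    and V: "a \<in> V" "b \<in> V" "c \<in> V" "a \<noteq> b" "b \<noteq> c" "col a \<noteq> col c"
  shows "\<exists>i \<le> Suc d. outside (lex_extend f s M col d i b) (lex_extend f s M col d i a)
           (lex_extend f s M col d i c)"
proof -
  have inj: "inj_on (f 0) (col ` V)"
    using f unfolding separating_def by blast
  consider "col b = col a" | "col b = col c" | "col b \<noteq> col a" "col b \<noteq> col c"
    by blast
  then show ?thesis
  proof cases
    case 1
    then show ?thesis
      by (intro ex_outside_tie[of d V s M f col, OF s inj ties]) (use V in auto)
  next
    case 2
    then show ?thesis
      by (subst outside_commute, intro ex_outside_tie[of d V s M f col, OF s inj ties]) (use V in auto)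
  next
    case 3
    then obtain i where i: "i \<le> d" "outside (f i (col b)) (f i (col a)) (f i (col c))"
      using f V unfolding separating_def by (metis distinct_length_2_or_more distinct_singleton imageI)
    then show ?thesis
      using outside_lex_extend[of d V s M a b c i f col, OF s] V by (meson le_SucI)
  qed
qed

section \<open>Repeated squaring\<close>

text \<open>A number below \<open>m * m\<close> is a pair of digits in base \<open>m\<close>. The
  leading digit serves as colour and the last digit, ordered by the same \<open>f i\<close>, breaks
  ties, so one extra order squares the size.\<close>

lemma separating_square:
  fixes m :: nat
  assumes f: "separating f d {..<m}"
  shows "\<exists>g. separating g (Suc d) {..<m * m}"
proof -
  let ?A = "(\<lambda>(i, x). \<bar>f i x\<bar>) ` ({..d} \<times> {..<m})"
  \<comment> \<open>A strict bound on all tie-breakers. For \<open>m = 0\<close> this maximum is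
    over an empty set, but then there is no digit to bound.\<close>
  define M where "M = Max ?A + 1"
  have M: "\<bar>f i x\<bar> < M" if "i \<le> d" "x < m" for i x
    unfolding M_def using that by (intro zle_add1_eq_le[THEN iffD2] Max_ge) force+
  let ?V = "{..<m * m}" and ?col = "\<lambda>x. x div m"
  define s where "s i x = f i (x mod m)" for i x
  define g where "g = lex_extend f s M ?col d"
  have inj: "inj_on (f 0) {..<m}"
    using f unfolding separating_def by blast
  have col: "?col ` ?V \<subseteq> {..<m}"
    by (auto intro: less_mult_imp_div_less)
  have modm: "x mod m < m" if "x \<in> ?V" for x
    using that by (cases "m = 0") auto
  have s: "\<bar>s i x\<bar> < M" if "i \<le> d" "x \<in> ?V" for i x
    using M modm that unfolding s_def by blast
  have ties: "x = y" if "x \<in> ?V" "y \<in> ?V" "?col x = ?col y" "s 0 x = s 0 y" for x y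
    using that inj modm unfolding s_def by (metis inj_onD lessThan_iff div_mod_decomp)
  have injV: "inj_on (f 0) (?col ` ?V)"
    using inj col by (rule inj_on_subset)
  have fV: "separating f d (?col ` ?V)"
    using f col by (rule separating_subset)
  have "separating g (Suc d) ?V"
    unfolding separating_def
  proof (intro conjI ballI impI)
    show "inj_on (g 0) ?V"
      unfolding g_def by (rule inj_on_lex_extend[of d ?V s M f ?col, OF s injV ties])
    fix a b c assume V: "a \<in> ?V" "b \<in> ?V" "c \<in> ?V" and dist: "distinct [a, b, c]"
    show "\<exists>i\<le>Suc d. outside (g i b) (g i a) (g i c)"
    proof (cases "?col a = ?col c")
      case False
      then show ?thesis
        unfolding g_def using V dist
        by (intro ex_outside_lex_extend[of d ?V s M f ?col, OF s fV ties]) auto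
    next
      case ac: True
      show ?thesis
      proof (cases "?col b = ?col a")
        case True
        \<comment> \<open>All leading digits agree, so the main terms cancel and the order of the
          last digits decides.\<close>
        with ac dist have "distinct [a mod m, b mod m, c mod m]"
          using div_mod_decomp[of a m] div_mod_decomp[of b m] div_mod_decomp[of c m] by auto
        then obtain i where i: "i \<le> d" "outside (s i b) (s i a) (s i c)"
          using f modm V unfolding separating_def s_def by (metis lessThan_iff)
        then have "outside (g i b) (g i a) (g i c)"
          using True ac unfolding g_def lex_extend_def outside_def by auto
        with i show ?thesis
          by (meson le_SucI)
      next
        case False
        \<comment> \<open>\<open>a\<close> and \<open>c\<close> share a leading digit that
          \<open>b\<close> lacks, so order \<open>0\<close> already puts \<open>b\<close> on one
          side of both.\<close>
        then have "f 0 (?col b) \<noteq> f 0 (?col a)"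
          using injV V by (auto dest: inj_onD)
        then have "outside (g 0 b) (g 0 a) (g 0 c)"
          unfolding g_def using ac V
          by (intro outside_lex_extend[of d ?V s M _ _ _ _ f ?col, OF s]) (auto simp: outside_def)
        then show ?thesis
          by blast
      qed
    qed
  qed
  then show ?thesis
    by blast
qed

lemma ex_separating: "\<exists>f. separating f d {..<(2::nat) ^ 2 ^ d}"
proof (induction d)
  case 0
  \<comment> \<open>Two elements contain no triple of distinct ones, so a single injective order
    suffices.\<close>
  have "separating (\<lambda>_. int) 0 {..<2}"
    unfolding separating_def by auto
  then show ?case
    by auto
next
  case (Suc d)
  then show ?case
    using separating_square[of _ d "2 ^ 2 ^ d"] by (auto simp: power_add[symmetric] mult_2)
qed

section \<open>Box representation of the full subdivision\<close>

text \<open>Reduces the geometry to integer inequalities: the intersection of two boxes is the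
  product of the intervals from the larger left end to the smaller right end.\<close>

lemma boxicity_le:
  fixes a b :: "'a \<Rightarrow> nat \<Rightarrow> int"
  assumes "k \<ge> 1"
    and ab: "\<And>v i. v \<in> pverts G \<Longrightarrow> i < k \<Longrightarrow> a v i \<le> b v i"
    and adj: "\<And>u v. u \<in> pverts G \<Longrightarrow> v \<in> pverts G \<Longrightarrow> u \<noteq> v \<Longrightarrow>
      (u, v) \<in> parcs G \<longleftrightarrow> (\<forall>i<k. a u i \<le> b v i \<and> a v i \<le> b u i)"
  shows "boxicity G \<le> k"
proof -
  define R where "R v = (\<Pi>\<^sub>E i\<in>{..<k}. {real_of_int (a v i)..real_of_int (b v i)})" for v
  have meet: "R u \<inter> R v \<noteq> {} \<longleftrightarrow> (\<forall>i<k. a u i \<le> b v i \<and> a v i \<le> b u i)"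
    if "u \<in> pverts G" "v \<in> pverts G" for u v
  proof -
    have "R u \<inter> R v = (\<Pi>\<^sub>E i\<in>{..<k}. {real_of_int (max (a u i) (a v i))..min (b u i) (b v i)})"
      unfolding R_def PiE_Int by (auto simp: of_int_max of_int_min)
    then show ?thesis
      using ab that by (auto simp: PiE_eq_empty_iff)
  qed
  have "kbox k (R v)" if "v \<in> pverts G" for v
    unfolding kbox_def R_def using ab[OF that]
    by (intro exI[of _ "\<lambda>i. real_of_int (a v i)"] exI[of _ "\<lambda>i. real_of_int (b v i)"]) simp
  then have "box_representation G k R"
    unfolding box_representation_def using meet adj by blast
  then show ?thesis
    unfolding boxicity_def using \<open>k \<ge> 1\<close> by (intro Least_le) blast
qed

lemma (in pair_graph) boxicity_full_subdivision_le:
  assumes col: "proper_coloring G (2 ^ 2 ^ d) col"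
  shows "boxicity (full_subdivision G) \<le> d + 3"
proof -
  let ?V = "pverts G"
  obtain f :: "nat \<Rightarrow> nat \<Rightarrow> int" where f: "separating f d {..<2 ^ 2 ^ d}"
    using ex_separating by blast
  have fV: "separating f d (col ` ?V)"
    using col unfolding proper_coloring_def by (intro separating_subset[OF f]) simp
  obtain h :: "'a \<Rightarrow> nat" and n where h: "h ` ?V = {i. i < n}" "inj_on h ?V"
    using finite_imp_inj_to_nat_seg[OF pair_finite_verts] by blast
  obtain t :: "'a set \<Rightarrow> nat" and m where t: "t ` uedges G = {i. i < m}" "inj_on t (uedges G)"
    using finite_imp_inj_to_nat_seg[OF finite_uedges] by blast
  define p where "p = lex_extend f (\<lambda>_ u. int (h u)) (int n) col d"
  have s: "\<bar>int (h u)\<bar> < int n" if "u \<in> ?V" for u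
    using h(1) that by auto
  have ties: "u = v" if "u \<in> ?V" "v \<in> ?V" "int (h u) = int (h v)" for u v
    using h(2) that by (auto dest: inj_onD)
  have inj_p: "inj_on (p 0) ?V"
    unfolding p_def using fV s ties
    by (intro inj_on_lex_extend[where V = ?V]) (simp_all add: separating_def)
  have sep: "\<exists>i \<le> Suc d. outside (p i w) (p i u) (p i v)"
    if "(u, v) \<in> parcs G" "w \<in> ?V" "w \<noteq> u" "w \<noteq> v" for u v w
    unfolding p_def
  proof (rule ex_outside_lex_extend[where V = ?V])
    show "u \<in> ?V" "v \<in> ?V"
      using that(1) in_arcsD1 in_arcsD2 by auto
    show "col u \<noteq> col v"
      using col that(1) unfolding proper_coloring_def by auto
    show "u \<noteq> w" "w \<noteq> v" "w \<in> ?V"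
      using that by auto
  qed (use s ties fV in simp_all)
  \<comment> \<open>Indices up to \<open>Suc d\<close> are the \<open>d + 2\<close> orders. At the
    last index \<open>d + 2\<close> the edges are distinct points in \<open>{0..<m}\<close>, and
    every vertex gets the interval from \<open>0\<close> to \<open>m\<close>.\<close>
  define a where "a x i = (case x of
      Inl u \<Rightarrow> if i \<le> Suc d then p i u else 0
    | Inr e \<Rightarrow> if i \<le> Suc d then Min (p i ` e) else int (t e))" for x i
  define b where "b x i = (case x of
      Inl u \<Rightarrow> if i \<le> Suc d then p i u else int m
    | Inr e \<Rightarrow> if i \<le> Suc d then Max (p i ` e) else int (t e))" for x i
  define meet where "meet x y \<longleftrightarrow> (\<forall>i < d + 3. a x i \<le> b y i \<and> a y i \<le> b x i)" for x y
  have fin: "finite e" "e \<noteq> {}" if "e \<in> uedges G" for e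
    using that unfolding uedges_def by auto
  have t_less: "t e < m" if "e \<in> uedges G" for e
    using t(1) that by auto
  have VV: "\<not> meet (Inl u) (Inl v)" if "u \<in> ?V" "v \<in> ?V" "u \<noteq> v" for u v
  proof -
    have "p 0 u \<noteq> p 0 v"
      using inj_p that by (auto dest: inj_onD)
    then show ?thesis
      by (auto simp: meet_def a_def b_def intro!: exI[of _ 0])
  qed
  have EE: "\<not> meet (Inr e) (Inr e')" if "e \<in> uedges G" "e' \<in> uedges G" "e \<noteq> e'" for e e'
  proof -
    have "t e \<noteq> t e'"
      using t(2) that by (auto dest: inj_onD)
    then show ?thesis
      by (auto simp: meet_def a_def b_def intro!: exI[of _ "Suc (Suc d)"])
  qed
  have VE: "meet (Inl u) (Inr e) \<longleftrightarrow> u \<in> e" if u: "u \<in> ?V" and e: "e \<in> uedges G" for u e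
  proof
    assume "u \<in> e"
    then show "meet (Inl u) (Inr e)"
      using fin[OF e] t_less[OF e] by (auto simp: meet_def a_def b_def)
  next
    assume meet: "meet (Inl u) (Inr e)"
    show "u \<in> e"
    proof (rule ccontr)
      assume "u \<notin> e"
      moreover obtain v w where vw: "e = {v, w}" "(v, w) \<in> parcs G"
        using e unfolding uedges_def by blast
      \<comment> \<open>As \<open>u\<close> is neither end of the edge, some order puts it outside
        the span of the two ends.\<close>
      ultimately obtain i where i: "i \<le> Suc d" "outside (p i u) (p i v) (p i w)"
        using sep u by blast
      then have "a (Inl u) i \<le> b (Inr e) i \<and> a (Inr e) i \<le> b (Inl u) i"
        using meet unfolding meet_def by simp
      then show False
        using i by (auto simp: a_def b_def vw(1) outside_def)
    qed
  qed
  have meet_commute: "meet x y \<longleftrightarrow> meet y x" for x y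
    unfolding meet_def by blast
  show ?thesis
  proof (rule boxicity_le)
    show "a x i \<le> b x i" if "x \<in> pverts (full_subdivision G)" for x i
      using that fin by (auto simp: full_subdivision_def a_def b_def)
    show "(x, y) \<in> parcs (full_subdivision G) \<longleftrightarrow>
        (\<forall>i < d + 3. a x i \<le> b y i \<and> a y i \<le> b x i)"
      if "x \<in> pverts (full_subdivision G)" "y \<in> pverts (full_subdivision G)" "x \<noteq> y" for x y
      unfolding meet_def[symmetric]
      using that VV EE VE meet_commute[of "Inr _" "Inl _"]
      by (cases x; cases y) (auto simp: full_subdivision_def)
  qed simp
qed

theorem theorem2:
  fixes H :: "'a pair_pre_digraph"
  assumes "pair_graph H"
    and "chromatic_number H \<ge> 2"
  shows "int (boxicity (full_subdivision H))
           \<le> \<lceil>log 2 (log 2 (real (chromatic_number H)))\<rceil> + 3"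
proof -
  interpret pair_graph H
    by fact
  let ?chi = "chromatic_number H"
  have log_ge: "log 2 (real ?chi) \<ge> 1"
    using assms(2) by (simp add: le_log_iff)
  define d where "d = nat \<lceil>log 2 (log 2 (real ?chi))\<rceil>"
  \<comment> \<open>With at least two colours the iterated logarithm is nonnegative, so
    \<open>nat\<close> truncates nothing in \<open>d\<close>.\<close>
  have "log 2 (log 2 (real ?chi)) \<ge> 0"
    using log_ge by simp
  then have d: "int d = \<lceil>log 2 (log 2 (real ?chi))\<rceil>"
    unfolding d_def by (simp add: order_less_le_trans[of "-1" 0])
  have "log 2 (log 2 (real ?chi)) \<le> real d"
    using d by linarith
  then have "log 2 (real ?chi) \<le> real (2 ^ d)"
    using log_ge by (simp add: log_le_iff powr_realpow)
  then have "real ?chi \<le> real (2 ^ 2 ^ d)"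
    using assms(2) by (simp add: log_le_iff powr_realpow flip: of_nat_power)
  then have "?chi \<le> 2 ^ 2 ^ d"
    by linarith
  moreover obtain col where "proper_coloring H ?chi col"
    using chromatic_number_attained by blast
  \<comment> \<open>Enlarging the palette keeps a colouring proper.\<close>
  ultimately have "proper_coloring H (2 ^ 2 ^ d) col"
    unfolding proper_coloring_def by fastforce
  then show ?thesis
    using boxicity_full_subdivision_le d by (metis of_nat_add of_nat_numeral of_nat_le_iff)
qed

end
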